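(* Let $P$ be a partially ordered pattern (a partial order on $\{1,\ldots,k\}$). If the permutation class $\operatorname{Av}(P)$ has a regular insertion encoding, then $P$ is bipartite, i.e. $P$ contains no chain of three elements (has height at most $2$).
   Context: A permutation $\pi$ of size $n$ contains the POP $P$ if there are indices $i_1<i_2<\cdots<i_k$ such that $\pi(i_a)<\pi(i_b)$ whenever $a<_P b$; $\operatorname{Av}(P)$ is the set of all permutations (of all sizes) avoiding $P$. Insertion encoding: a permutation of size $n$ is built by inserting the values $1,2,\ldots,n$ in increasing order into a configuration, a word over the symbols $\bullet$ (placed entry) and $\diamond$ (slot), starting from the single slot $\diamond$. At step $j$ the value $j$ is inserted into the $i$-th slot from the left by one of four operations: $f_i$ replaces that slot by $\bullet$, $l_i$ by $\bullet\diamond$, $r_i$ by $\diamond\bullet$, $m_i$ by $\diamond\bullet\diamond$; after $n$ steps no slots remain and the left-to-right sequence of inserted values is the permutation. Every permutation has a unique such encoding as a word over the letters $\{f_i,l_i,r_i,m_i : i\ge 1\}$. A permutation class has a regular insertion encoding if the set of encodings of its members is a regular language over a finite alphabet. *)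

theory Defs
  imports "HOL-Combinatorics.Combinatorics"
begin

text \<open>Permutations are lists in one-line notation; a list of length \<open>n\<close> is a permutation
  of size \<open>n\<close> if it lists the values \<open>1, \<dots>, n\<close>.\<close>

definition perms :: "nat list set" where
  "perms = (\<Union>n. permutations_of_set {1..n})"

text \<open>A partially ordered pattern of size \<open>k\<close> is a reflexive relation \<open>P\<close> with
  \<^term>\<open>partial_order_on {1..k} P\<close>. The elements of the pattern are numbered from 1, whereas
  the positions of \<open>\<pi>\<close> chosen by \<open>i\<close> are list indices, numbered from 0.\<close>

definition pop_less :: "nat rel \<Rightarrow> nat \<Rightarrow> nat \<Rightarrow> bool" where
  "pop_less P a b \<longleftrightarrow> (a, b) \<in> P \<and> a \<noteq> b"

definition contains_pop :: "nat \<Rightarrow> nat rel \<Rightarrow> nat list \<Rightarrow> bool" where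
  "contains_pop k P \<pi> \<longleftrightarrow>
     (\<exists>i :: nat \<Rightarrow> nat. strict_mono_on {1..k} i \<and> i ` {1..k} \<subseteq> {..<length \<pi>} \<and>
        (\<forall>a\<in>{1..k}. \<forall>b\<in>{1..k}. pop_less P a b \<longrightarrow> \<pi> ! i a < \<pi> ! i b))"

definition Av :: "nat \<Rightarrow> nat rel \<Rightarrow> nat list set" where
  "Av k P = {\<pi> \<in> perms. \<not> contains_pop k P \<pi>}"

definition bipartite_pop :: "nat rel \<Rightarrow> bool" where
  "bipartite_pop P \<longleftrightarrow> \<not> (\<exists>C \<in> Chains P. card C = 3)"

text \<open>A placed entry (a bullet) carries the value inserted there, so that the permutation can
  be read off from a configuration without slots.\<close>

datatype cell = Slot | Entry nat

datatype letter = Ins_f nat | Ins_l nat | Ins_r nat | Ins_m nat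

definition num_slots :: "cell list \<Rightarrow> nat" where
  "num_slots C = count_list C Slot"

text \<open>\<open>insertion_step v a C D\<close>: inserting the value \<open>v\<close> into \<open>C\<close> by the letter \<open>a\<close> gives \<open>D\<close>.
  The slot displayed in \<open>xs @ Slot # ys\<close> is the \<open>i\<close>-th from the left for
  \<open>i = Suc (num_slots xs)\<close>; in particular slots are numbered from 1.\<close>

inductive insertion_step :: "nat \<Rightarrow> letter \<Rightarrow> cell list \<Rightarrow> cell list \<Rightarrow> bool" for v :: nat where
  step_f: "i = Suc (num_slots xs) \<Longrightarrow>
     insertion_step v (Ins_f i) (xs @ Slot # ys) (xs @ [Entry v] @ ys)"
| step_l: "i = Suc (num_slots xs) \<Longrightarrow>
     insertion_step v (Ins_l i) (xs @ Slot # ys) (xs @ [Entry v, Slot] @ ys)"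
| step_r: "i = Suc (num_slots xs) \<Longrightarrow>
     insertion_step v (Ins_r i) (xs @ Slot # ys) (xs @ [Slot, Entry v] @ ys)"
| step_m: "i = Suc (num_slots xs) \<Longrightarrow>
     insertion_step v (Ins_m i) (xs @ Slot # ys) (xs @ [Slot, Entry v, Slot] @ ys)"

inductive builds :: "letter list \<Rightarrow> cell list \<Rightarrow> bool" where
  builds_Nil: "builds [] [Slot]"
| builds_snoc: "builds w C \<Longrightarrow> insertion_step (Suc (length w)) a C D \<Longrightarrow> builds (w @ [a]) D"

definition encodes :: "letter list \<Rightarrow> nat list \<Rightarrow> bool" where
  "encodes w \<pi> \<longleftrightarrow> builds w (map Entry \<pi>)"

text \<open>The empty permutation has no encoding, since the initial configuration contains a slot.\<close>

definition encodings :: "nat list set \<Rightarrow> letter list set" where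
  "encodings X = {w. \<exists>\<pi>\<in>X. encodes w \<pi>}"

text \<open>Recognisability by a deterministic finite automaton over the finite alphabet \<open>A\<close>. States
  are natural numbers, which is no restriction as the state set is finite.\<close>

definition regular_language :: "'a set \<Rightarrow> 'a list set \<Rightarrow> bool" where
  "regular_language A L \<longleftrightarrow> finite A \<and>
     (\<exists>(Q :: nat set) q\<^sub>0 \<delta> F. finite Q \<and> q\<^sub>0 \<in> Q \<and> F \<subseteq> Q \<and> (\<forall>q\<in>Q. \<forall>a\<in>A. \<delta> q a \<in> Q) \<and>
        L = {w \<in> lists A. foldl \<delta> q\<^sub>0 w \<in> F})"

definition regular_insertion_encoding :: "nat list set \<Rightarrow> bool" where
  "regular_insertion_encoding X \<longleftrightarrow> (\<exists>A. regular_language A (encodings X))"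

end

theory Submission
  imports Defs
begin

text \<open>A finite automaton can complete any prefix of an accepted word by a suffix of bounded length.
  In an insertion encoding every remaining slot costs at least one further letter, so a regular
  insertion encoding bounds the number of slots in all configurations. On the other hand, if \<open>P\<close>
  has a chain \<open>a < b < c\<close>, interleave \<open>n\<close> small values (on even positions) with \<open>n\<close> large values
  (on odd positions), both monotone. A small image of \<open>b\<close> forces a small image of \<open>a\<close>, and a large
  one forces a large image of \<open>c\<close>; hence \<open>P\<close> is avoided as soon as the small values run against the
  direction prescribed by \<open>a, b\<close> and the large ones against that prescribed by \<open>b, c\<close>. Once the
  small values are placed, there are \<open>n\<close> slots.\<close>

subsection \<open>Counting slots\<close>

fun slot_change :: "letter \<Rightarrow> int" where
  "slot_change (Ins_f i) = -1"
| "slot_change (Ins_l i) = 0"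
| "slot_change (Ins_r i) = 0"
| "slot_change (Ins_m i) = 1"

lemma num_slots_insertion_step:
  "insertion_step v a C D \<Longrightarrow> int (num_slots D) = int (num_slots C) + slot_change a"
  by (induction rule: insertion_step.induct) (auto simp: num_slots_def)

lemma num_slots_builds:
  "builds w C \<Longrightarrow> int (num_slots C) = 1 + sum_list (map slot_change w)"
proof (induction rule: builds.induct)
  case builds_Nil
  then show ?case by (simp add: num_slots_def)
next
  case (builds_snoc w C a D)
  then show ?case using num_slots_insertion_step[OF builds_snoc.hyps(2)] by simp
qed

lemma sum_list_slot_change_ge: "- int (length w) \<le> sum_list (map slot_change w)"
proof (induction w)
  case (Cons a w)
  then show ?case by (cases a) auto
qed simp

text \<open>No letter removes more than one slot, and the final configuration has none left.\<close>

lemma num_slots_le_length_completion: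
  assumes "builds u C" and "encodes (u @ v) \<pi>"
  shows "num_slots C \<le> length v"
proof -
  have "num_slots (map Entry \<pi>) = 0"
    by (induction \<pi>) (auto simp: num_slots_def)
  with assms(2) have "0 = 1 + sum_list (map slot_change u) + sum_list (map slot_change v)"
    using num_slots_builds[of "u @ v" "map Entry \<pi>"] by (simp add: encodes_def)
  then show ?thesis
    using num_slots_builds[OF assms(1)] sum_list_slot_change_ge[of v] by linarith
qed

subsection \<open>Existence of encodings\<close>

text \<open>A slot stands for a maximal run of positions still to be filled, so adjacent
  \<open>Slot\<close>s have to merge. For distinct \<open>\<pi>\<close> the entries differ, and
  \<open>remdups_adj\<close> merges nothing else.\<close>

definition config :: "nat \<Rightarrow> nat list \<Rightarrow> cell list" where
  "config j \<pi> = remdups_adj (map (\<lambda>x. if x \<le> j then Entry x else Slot) \<pi>)"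

text \<open>Serves to compare what lies left of a position before and after that position is filled:
  with \<open>x = Slot\<close>, the remainder \<open>s\<close> tells whether a slot survives next to
  the new entry.\<close>

lemma remdups_adj_snoc_cases:
  obtains X s where "remdups_adj A = X @ s" "s = [] \<or> s = [x]" "remdups_adj (A @ [x]) = X @ [x]"
proof (cases "A \<noteq> [] \<and> last A = x")
  case True
  then obtain A' where A: "A = A' @ [x]" by (metis append_butlast_last_id)
  obtain X where X: "remdups_adj A = X @ [x]"
    using A by (metis last_remdups_adj remdups_adj_Nil_iff snoc_eq_iff_butlast)
  have "remdups_adj (A @ [x]) = remdups_adj A"
    unfolding A using remdups_adj_append_two[of A' x x] by simp
  with X show ?thesis by (intro that[of X "[x]"]) auto
next
  case False
  then have "remdups_adj (A @ [x]) = remdups_adj A @ [x]"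
    by (cases A rule: rev_cases) (auto simp: remdups_adj_append_two)
  then show ?thesis by (intro that[of "remdups_adj A" "[]"]) auto
qed

lemma remdups_adj_Cons_cases:
  obtains Y t where "remdups_adj B = t @ Y" "t = [] \<or> t = [x]" "remdups_adj (x # B) = x # Y"
proof -
  obtain X s where *: "remdups_adj (rev B) = X @ s" "s = [] \<or> s = [x]"
    "remdups_adj (rev B @ [x]) = X @ [x]"
    by (rule remdups_adj_snoc_cases)
  have "remdups_adj B = rev (X @ s)"
    unfolding *(1)[symmetric] by simp
  moreover have "remdups_adj (x # B) = rev (X @ [x])"
    unfolding *(3)[symmetric] using remdups_adj_rev[of "x # B"] by simp
  ultimately show ?thesis using *(2) by (intro that[of s "rev X"]) auto
qed

lemma remdups_adj_append_fresh:
  assumes "x \<notin> set A" "x \<notin> set B"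
  shows "remdups_adj (A @ x # B) = remdups_adj A @ x # remdups_adj B"
proof -
  have "remdups_adj (x # B) = x # remdups_adj B"
    using assms(2) by (cases B) auto
  moreover have "remdups_adj (A @ [x]) = remdups_adj A @ [x]"
    using assms(1) by (cases A rule: rev_cases) (auto simp: remdups_adj_append_two)
  ultimately show ?thesis by (simp add: remdups_adj_append[of A x B])
qed

lemma insertion_step_config:
  assumes "distinct \<pi>" "Suc j \<in> set \<pi>"
  shows "\<exists>a. insertion_step (Suc j) a (config j \<pi>) (config (Suc j) \<pi>)"
proof -
  let ?f = "\<lambda>j x. if x \<le> j then Entry x else Slot"
  obtain xs ys where \<pi>: "\<pi> = xs @ Suc j # ys"
    using assms(2) by (meson split_list)
  define A where "A = map (?f j) xs"
  define B where "B = map (?f j) ys"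
  have notin: "Suc j \<notin> set xs" "Suc j \<notin> set ys" using assms(1) \<pi> by auto
  then have "map (?f (Suc j)) xs = A" "map (?f (Suc j)) ys = B"
    by (auto simp: A_def B_def le_Suc_eq)
  moreover have "Entry (Suc j) \<notin> set A" "Entry (Suc j) \<notin> set B"
    by (auto simp: A_def B_def split: if_splits)
  ultimately have D: "config (Suc j) \<pi> = remdups_adj A @ Entry (Suc j) # remdups_adj B"
    by (simp add: config_def \<pi> remdups_adj_append_fresh)
  obtain X s where X: "remdups_adj A = X @ s" "s = [] \<or> s = [Slot]"
    "remdups_adj (A @ [Slot]) = X @ [Slot]"
    by (rule remdups_adj_snoc_cases)
  obtain Y t where Y: "remdups_adj B = t @ Y" "t = [] \<or> t = [Slot]"
    "remdups_adj (Slot # B) = Slot # Y"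
    by (rule remdups_adj_Cons_cases)
  have "config j \<pi> = remdups_adj (A @ Slot # B)"
    by (simp add: config_def \<pi> A_def B_def)
  then have C: "config j \<pi> = X @ Slot # Y"
    using X(3) Y(3) by (simp add: remdups_adj_append[of A Slot B])
  note steps = insertion_step.intros[OF refl, of "Suc j" X Y]
  \<comment> \<open>The run containing \<open>Suc j\<close> may continue to the left
    (\<open>s\<close>) and to the right (\<open>t\<close>): neither gives \<open>Ins_f\<close>, only
    right \<open>Ins_l\<close>, only left \<open>Ins_r\<close>, both \<open>Ins_m\<close>.\<close>
  show ?thesis
    using X(2) Y(2) steps unfolding C D X(1) Y(1) by auto
qed

text \<open>Starting at an arbitrary stage \<open>i\<close> allows the encoding to be cut at a
  chosen configuration. The length of \<open>u\<close> matters because \<open>builds\<close> reads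
  the next value off it.\<close>

lemma builds_config_extend:
  assumes "\<pi> \<in> permutations_of_set {1..n}" "i \<le> j" "j \<le> n"
    and "builds u (config i \<pi>)" "length u = i"
  shows "\<exists>v. length v = j - i \<and> builds (u @ v) (config j \<pi>)"
  using assms(2,3)
proof (induction j rule: dec_induct)
  case base
  then show ?case using assms(4) by simp
next
  case (step j)
  then obtain v where v: "length v = j - i" "builds (u @ v) (config j \<pi>)" by auto
  have "distinct \<pi>" "Suc j \<in> set \<pi>"
    using assms(1) step.prems by (auto simp: permutations_of_set_def)
  then obtain a where "insertion_step (Suc j) a (config j \<pi>) (config (Suc j) \<pi>)"
    using insertion_step_config by blast
  then have "builds ((u @ v) @ [a]) (config (Suc j) \<pi>)"
    using v step.hyps assms(5) by (intro builds_snoc) auto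
  then show ?case using v step.hyps by (intro exI[of _ "v @ [a]"]) auto
qed

lemma builds_config_0:
  assumes "\<pi> \<in> permutations_of_set {1..n}" "0 < n"
  shows "builds [] (config 0 \<pi>)"
proof -
  have "\<pi> \<noteq> []" "0 \<notin> set \<pi>"
    using assms by (auto simp: permutations_of_set_def)
  then have "map (\<lambda>x. if x \<le> 0 then Entry x else Slot) \<pi> = replicate (length \<pi>) Slot"
    by (intro replicate_eqI) auto
  then have "config 0 \<pi> = [Slot]"
    using \<open>\<pi> \<noteq> []\<close> by (simp add: config_def remdups_adj_replicate)
  then show ?thesis by (simp add: builds_Nil)
qed

lemma config_size:
  assumes "\<pi> \<in> permutations_of_set {1..n}"
  shows "config n \<pi> = map Entry \<pi>"
proof -
  have "map (\<lambda>x. if x \<le> n then Entry x else Slot) \<pi> = map Entry \<pi>"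
    using assms by (auto simp: permutations_of_set_def)
  moreover have "distinct (map Entry \<pi>)"
    using assms by (auto simp: permutations_of_set_def distinct_map inj_on_def)
  ultimately show ?thesis unfolding config_def by (metis remdups_adj_distinct)
qed

lemma encoding_through_config:
  assumes "\<pi> \<in> permutations_of_set {1..n}" "0 < n" "j \<le> n"
  obtains u v where "builds u (config j \<pi>)" "encodes (u @ v) \<pi>"
proof -
  obtain u where u: "length u = j" "builds u (config j \<pi>)"
    using builds_config_extend[OF assms(1) _ assms(3) builds_config_0[OF assms(1,2)]] by auto
  then obtain v where "builds (u @ v) (config n \<pi>)"
    using builds_config_extend[OF assms(1,3)] by blast
  with u show ?thesis
    using config_size[OF assms(1)] that by (simp add: encodes_def)
qed

subsection \<open>Boundedness from regularity\<close>

text \<open>Whether a suffix completes \<open>u\<close> depends only on the state reached by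
  \<open>u\<close>, so one fixed suffix per state suffices, and there are finitely many
  states.\<close>

lemma regular_language_bounded_completion:
  assumes "regular_language A L"
  obtains N where "\<And>u v. u @ v \<in> L \<Longrightarrow> \<exists>v'. u @ v' \<in> L \<and> length v' \<le> N"
proof -
  from assms obtain Q :: "nat set" and q\<^sub>0 \<delta> F where Q: "finite Q" "q\<^sub>0 \<in> Q"
    and \<delta>: "\<forall>q\<in>Q. \<forall>a\<in>A. \<delta> q a \<in> Q" and L: "L = {w \<in> lists A. foldl \<delta> q\<^sub>0 w \<in> F}"
    unfolding regular_language_def by blast
  have run: "foldl \<delta> q w \<in> Q" if "q \<in> Q" "w \<in> lists A" for q w
    using that \<delta> by (induction w arbitrary: q) auto
  \<comment> \<open>For a state that cannot reach \<open>F\<close> the choice is arbitrary; this can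
    only enlarge the maximum below.\<close>
  define c where "c q = (SOME v. v \<in> lists A \<and> foldl \<delta> q v \<in> F)" for q
  have "\<exists>v'. u @ v' \<in> L \<and> length v' \<le> Max ((length \<circ> c) ` Q)" if "u @ v \<in> L" for u v
  proof -
    let ?q = "foldl \<delta> q\<^sub>0 u"
    have "u \<in> lists A" "v \<in> lists A \<and> foldl \<delta> ?q v \<in> F" using that by (auto simp: L)
    then have "c ?q \<in> lists A \<and> foldl \<delta> ?q (c ?q) \<in> F" "?q \<in> Q"
      unfolding c_def using run[OF Q(2)] by (metis (mono_tags, lifting) someI_ex, blast)
    then show ?thesis
      using \<open>u \<in> lists A\<close> Q(1) by (intro exI[of _ "c ?q"]) (auto simp: L intro!: Max_ge)
  qed
  then show ?thesis using that by blast
qed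

lemma regular_insertion_encoding_bounded_slots:
  assumes "regular_insertion_encoding X"
  obtains N where "\<And>n \<pi> j. \<pi> \<in> X \<Longrightarrow> \<pi> \<in> permutations_of_set {1..n} \<Longrightarrow> 0 < n \<Longrightarrow> j \<le> n \<Longrightarrow>
    num_slots (config j \<pi>) \<le> N"
proof -
  obtain A where "regular_language A (encodings X)"
    using assms by (auto simp: regular_insertion_encoding_def)
  then obtain N where N: "\<And>u v. u @ v \<in> encodings X \<Longrightarrow>
      \<exists>v'. u @ v' \<in> encodings X \<and> length v' \<le> N"
    using regular_language_bounded_completion by blast
  show ?thesis
  proof (rule that)
    fix n \<pi> j
    assume "\<pi> \<in> X" "\<pi> \<in> permutations_of_set {1..n}" "0 < n" "j \<le> n"
    then obtain u v where u: "builds u (config j \<pi>)" and "encodes (u @ v) \<pi>"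
      using encoding_through_config by blast
    \<comment> \<open>The short completion may encode another member of \<open>X\<close>; this is
      harmless, as the slots of \<open>config j \<pi>\<close> are determined by the prefix
      \<open>u\<close>.\<close>
    with \<open>\<pi> \<in> X\<close> obtain v' \<pi>' where "encodes (u @ v') \<pi>'" "length v' \<le> N"
      using N[of u v] by (auto simp: encodings_def)
    then show "num_slots (config j \<pi>) \<le> N"
      using num_slots_le_length_completion[OF u] by fastforce
  qed
qed

subsection \<open>Interleaved monotone sequences\<close>

text \<open>Meant for \<open>p < 2 * n\<close>, where \<open>p div 2 < n\<close> keeps the
  subtractions from truncating: even positions receive \<open>1..n\<close>, odd ones
  \<open>n+1..2n\<close>.\<close>

definition interleave_val :: "bool \<Rightarrow> bool \<Rightarrow> nat \<Rightarrow> nat \<Rightarrow> nat" where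
  "interleave_val small_dec large_dec n p =
     (if even p then (if small_dec then n - p div 2 else Suc (p div 2))
      else (if large_dec then 2 * n - p div 2 else Suc (n + p div 2)))"

definition interleave :: "bool \<Rightarrow> bool \<Rightarrow> nat \<Rightarrow> nat list" where
  "interleave small_dec large_dec n = map (interleave_val small_dec large_dec n) [0..<2 * n]"

lemma interleave_val_le_iff:
  "p < 2 * n \<Longrightarrow> interleave_val sd ld n p \<le> n \<longleftrightarrow> even p"
  by (cases "even p") (auto simp: interleave_val_def)

lemma interleave_val_less_even:
  assumes "even p" "even q" "p < 2 * n" "q < 2 * n"
  shows "interleave_val sd ld n p < interleave_val sd ld n q \<longleftrightarrow> (if sd then q < p else p < q)"
proof -
  obtain x y where "p = 2 * x" "q = 2 * y" using assms(1,2) by (meson evenE)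
  then show ?thesis using assms(3,4) by (auto simp: interleave_val_def)
qed

lemma interleave_val_less_odd:
  assumes "odd p" "odd q" "p < 2 * n" "q < 2 * n"
  shows "interleave_val sd ld n p < interleave_val sd ld n q \<longleftrightarrow> (if ld then q < p else p < q)"
proof -
  obtain x y where "p = 2 * x + 1" "q = 2 * y + 1" using assms(1,2) by (meson oddE)
  then show ?thesis using assms(3,4) by (auto simp: interleave_val_def)
qed

lemma interleave_permutation: "interleave sd ld n \<in> permutations_of_set {1..2 * n}"
proof -
  let ?f = "interleave_val sd ld n"
  have inj: "inj_on ?f {..<2 * n}"
  proof (rule inj_onI)
    fix p q assume *: "p \<in> {..<2 * n}" "q \<in> {..<2 * n}" "?f p = ?f q"
    \<comment> \<open>The value reveals the parity of its position; within one parity class the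
      values are strictly monotone.\<close>
    then have "even p \<longleftrightarrow> even q" using interleave_val_le_iff by (metis lessThan_iff)
    then show "p = q"
      using * interleave_val_less_even[of p q n sd ld] interleave_val_less_even[of q p n sd ld]
        interleave_val_less_odd[of p q n sd ld] interleave_val_less_odd[of q p n sd ld]
      by (cases p q rule: linorder_cases) (auto split: if_splits)
  qed
  have "?f ` {..<2 * n} \<subseteq> {1..2 * n}"
    by (auto simp: interleave_val_def)
  then have "?f ` {..<2 * n} = {1..2 * n}"
    using card_image[OF inj] by (intro card_subset_eq) auto
  then show ?thesis
    using inj by (auto simp: permutations_of_set_def interleave_def distinct_map
        atLeast0LessThan)
qed

text \<open>At stage \<open>n\<close> exactly the even positions are filled, so entries and slots
  alternate and no slots merge.\<close>

lemma num_slots_config_interleave: "num_slots (config n (interleave sd ld n)) = n"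
proof -
  let ?g = "\<lambda>p. if even p then Entry (interleave_val sd ld n p) else Slot"
  have "map (\<lambda>x. if x \<le> n then Entry x else Slot) (interleave sd ld n) = map ?g [0..<2 * n]"
    by (auto simp: interleave_def interleave_val_le_iff)
  moreover have "distinct_adj (map ?g [0..<2 * n])"
    by (auto simp: distinct_adj_conv_nth)
  then have "remdups_adj (map ?g [0..<2 * n]) = map ?g [0..<2 * n]"
    by (simp add: distinct_adj_altdef)
  \<comment> \<open>The number of positions varies with \<open>m\<close> while \<open>?g\<close>
    keeps \<open>n\<close>, so that induction applies.\<close>
  moreover have "count_list (map ?g [0..<2 * m]) Slot = m" for m
    by (induction m) auto
  ultimately show ?thesis by (simp add: config_def num_slots_def)
qed

text \<open>The flags \<open>a < b\<close> and \<open>b < c\<close> compare places in the pattern,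
  not elements under \<open>P\<close>; by \<open>ord\<close> the chosen positions are in the same
  order.\<close>

lemma interleave_avoids_chain:
  assumes abc: "a \<in> {1..k}" "b \<in> {1..k}" "c \<in> {1..k}" and "pop_less P a b" "pop_less P b c"
  shows "\<not> contains_pop k P (interleave (a < b) (b < c) n)"
proof
  let ?f = "interleave_val (a < b) (b < c) n"
  assume "contains_pop k P (interleave (a < b) (b < c) n)"
  then obtain i where i: "strict_mono_on {1..k} i"
    and bound: "\<And>x. x \<in> {1..k} \<Longrightarrow> i x < 2 * n"
    and less: "\<And>x y. x \<in> {1..k} \<Longrightarrow> y \<in> {1..k} \<Longrightarrow> pop_less P x y \<Longrightarrow> ?f (i x) < ?f (i y)"
    unfolding contains_pop_def by (fastforce simp: interleave_def image_subset_iff)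
  have ord: "i x < i y \<longleftrightarrow> x < y" if "x \<in> {1..k}" "y \<in> {1..k}" for x y
    using strict_mono_on_less[OF i] that by blast
  have lt: "?f (i a) < ?f (i b)" "?f (i b) < ?f (i c)"
    using less assms by auto
  show False
  proof (cases "even (i b)")
    case True
    then have "even (i a)"
      using lt(1) interleave_val_le_iff bound abc by (metis less_imp_le order_trans)
    \<comment> \<open>Small values fall if \<open>a < b\<close> and rise if \<open>b < a\<close>, so
      the value at \<open>i a\<close> exceeds that at \<open>i b\<close> either way.\<close>
    then show False
      using True lt(1) bound abc ord assms(4)
      by (auto simp: interleave_val_less_even split: if_splits)
  next
    case False
    then have "odd (i c)"
      using lt(2) interleave_val_le_iff bound abc by (metis less_imp_le order_trans)
    then show False
      using False lt(2) bound abc ord assms(5)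
      by (auto simp: interleave_val_less_odd split: if_splits)
  qed
qed

lemma chain_of_three:
  assumes P: "partial_order_on A P" and "C \<in> Chains P" "card C = 3"
  obtains a b c where "a \<in> A" "b \<in> A" "c \<in> A" "pop_less P a b" "pop_less P b c"
proof -
  obtain x y z where C: "C = {x, y, z}" "x \<noteq> y" "y \<noteq> z" "x \<noteq> z"
    using \<open>card C = 3\<close> by (auto simp: card_3_iff)
  have "P \<subseteq> A \<times> A" using P by (auto simp: partial_order_on_def preorder_on_def refl_on_def)
  moreover have "(x, y) \<in> P \<or> (y, x) \<in> P" "(y, z) \<in> P \<or> (z, y) \<in> P" "(x, z) \<in> P \<or> (z, x) \<in> P"
    using \<open>C \<in> Chains P\<close> by (auto simp: C(1) Chains_def)
  \<comment> \<open>However the three pairs are oriented, some directed path visits all three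
    elements.\<close>
  ultimately show ?thesis
    using that C(2-4) unfolding pop_less_def by blast
qed

theorem theorem4:
  fixes k :: nat and P :: "nat rel"
  assumes "partial_order_on {1..k} P"
    and "regular_insertion_encoding (Av k P)"
  shows "bipartite_pop P"
proof (rule ccontr)
  assume "\<not> bipartite_pop P"
  then obtain a b c where abc: "a \<in> {1..k}" "b \<in> {1..k}" "c \<in> {1..k}"
    "pop_less P a b" "pop_less P b c"
    using chain_of_three[OF assms(1)] unfolding bipartite_pop_def by metis
  obtain N where N: "\<And>n \<pi> j. \<pi> \<in> Av k P \<Longrightarrow> \<pi> \<in> permutations_of_set {1..n} \<Longrightarrow> 0 < n \<Longrightarrow>
      j \<le> n \<Longrightarrow> num_slots (config j \<pi>) \<le> N"
    using regular_insertion_encoding_bounded_slots[OF assms(2)] by blast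
  \<comment> \<open>With \<open>Suc N\<close> small values, stage \<open>Suc N\<close> has one slot
    more than the bound allows.\<close>
  let ?\<pi> = "interleave (a < b) (b < c) (Suc N)"
  have perm: "?\<pi> \<in> permutations_of_set {1..2 * Suc N}" by (rule interleave_permutation)
  then have "?\<pi> \<in> Av k P"
    unfolding Av_def perms_def using interleave_avoids_chain[OF abc] by blast
  then have "num_slots (config (Suc N) ?\<pi>) \<le> N"
    by (rule N[OF _ perm]) auto
  then show False by (simp add: num_slots_config_interleave)
qed

end
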